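(* Let $r\ge 2$. Then for every $\varepsilon>0$, \[ \sum_{n_1,\ldots,n_r\le x} \tau^*(n_1\cdots n_r)= x^r P^*_r(\log x)+ O(x^{r-1/2+\varepsilon}), \] where $P^*_r(t)$ is a polynomial in $t$ of degree $r$ with leading coefficient \[ K_{P^*,r}=\prod_p \left(1-\frac1{p} \right)^r \left(2- \left(1-\frac1{p} \right)^r \right). \]
   Context: $\tau^*(n)=2^{\omega(n)}$, where $\omega(n)$ is the number of distinct prime divisors of $n$ (the number of unitary divisors of $n$). Products over $p$ run over primes. *)

theory Defs
  imports
    "HOL-Analysis.Infinite_Products"
    "HOL-Computational_Algebra.Computational_Algebra"
    "HOL-Library.FuncSet"
    "HOL-Library.Landau_Symbols"
begin

definition omega :: "nat \<Rightarrow> nat" where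
  "omega n = card (prime_factors n)"

definition tau_star :: "nat \<Rightarrow> nat" where
  "tau_star n = 2 ^ omega n"

definition tau_star_sum :: "nat \<Rightarrow> real \<Rightarrow> nat" where
  "tau_star_sum r x =
     (\<Sum>n \<in> {1..r} \<rightarrow>\<^sub>E {m. 1 \<le> m \<and> real m \<le> x}. tau_star (\<Prod>i\<in>{1..r}. n i))"

end

theory Submission imports Defs "HOL-Analysis.Analysis" begin

text \<open>
  For a prime \<open>p\<close> let \<open>T i\<close> replace the coordinate \<open>y i\<close> by \<open>y i / p\<close>, let
  \<open>U = (\<Prod>i. 1 - T i)\<close> and \<open>A = 2 * U - U\<^sup>2 = 1 - (1 - U)\<^sup>2\<close>. This is the
  Euler factor at \<open>p\<close> of the multiple Dirichlet series of \<open>tau_star (n 1 \<cdots> n r)\<close> divided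
  by \<open>\<zeta>(s 1)\<^sup>2 \<cdots> \<zeta>(s r)\<^sup>2\<close>, read as an operator on functions of \<open>y\<close>.
  Applying \<open>A\<close> for all primes up to \<open>N\<close> to the product of the divisor summatory functions at
  \<open>x * y i\<close> gives, at \<open>y = 1\<close>, the sum of \<open>tau_star\<close> for every \<open>N \<ge> x\<close>.
  By Dirichlet's hyperbola method each divisor sum is \<open>z * (ln z + 2 * \<gamma> - 1) + O(sqrt z)\<close>.
  Since \<open>1 - A\<close> is the square of \<open>1 - U\<close>, it is of size \<open>p powr (- 2 * s)\<close> on functions of
  order \<open>y powr s\<close>, so for \<open>s > 1/2\<close> the product of the operators is bounded uniformly in
  \<open>N\<close> (this keeps the error term) and converges as \<open>N \<rightarrow> \<infinity>\<close> (this gives the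
  coefficients of the polynomial).
\<close>

subsection \<open>Euler factors as operators\<close>

definition shrink :: "'i set \<Rightarrow> nat \<Rightarrow> ('i \<Rightarrow> real) \<Rightarrow> 'i \<Rightarrow> real" where
  "shrink S q y = (\<lambda>i. if i \<in> S then y i / real q else y i)"

text \<open>Expansion of \<open>U\<close> over subsets: the term for \<open>S\<close> applies
  \<open>T i\<close> for exactly the \<open>i\<close> in \<open>S\<close>.\<close>

definition sieve_op :: "'i set \<Rightarrow> nat \<Rightarrow> (('i \<Rightarrow> real) \<Rightarrow> real) \<Rightarrow> ('i \<Rightarrow> real) \<Rightarrow> real" where
  "sieve_op I q \<Phi> y = (\<Sum>S\<in>Pow I. (-1) ^ card S * \<Phi> (shrink S q y))"

definition local_op :: "'i set \<Rightarrow> nat \<Rightarrow> (('i \<Rightarrow> real) \<Rightarrow> real) \<Rightarrow> ('i \<Rightarrow> real) \<Rightarrow> real" where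
  "local_op I q \<Phi> y = 2 * sieve_op I q \<Phi> y - sieve_op I q (sieve_op I q \<Phi>) y"

primrec euler_op :: "'i set \<Rightarrow> nat \<Rightarrow> (('i \<Rightarrow> real) \<Rightarrow> real) \<Rightarrow> ('i \<Rightarrow> real) \<Rightarrow> real" where
  "euler_op I 0 \<Phi> = \<Phi>"
| "euler_op I (Suc N) \<Phi> =
     (if prime (Suc N) then local_op I (Suc N) (euler_op I N \<Phi>) else euler_op I N \<Phi>)"

lemma shrink_empty [simp]: "shrink {} q y = y"
  by (simp add: shrink_def)

lemma shrink_pos: "q > 0 \<Longrightarrow> \<forall>i\<in>I. y i > 0 \<Longrightarrow> \<forall>i\<in>I. shrink S q y i > 0"
  by (simp add: shrink_def)

lemma sieve_op_sum:
  "sieve_op I q (\<lambda>y. \<Sum>j\<in>T. a j * \<Phi> j y) = (\<lambda>y. \<Sum>j\<in>T. a j * sieve_op I q (\<Phi> j) y)"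
proof
  fix y
  have "sieve_op I q (\<lambda>y. \<Sum>j\<in>T. a j * \<Phi> j y) y =
      (\<Sum>S\<in>Pow I. \<Sum>j\<in>T. a j * ((-1) ^ card S * \<Phi> j (shrink S q y)))"
    by (simp add: sieve_op_def sum_distrib_left mult_ac)
  also have "\<dots> = (\<Sum>j\<in>T. \<Sum>S\<in>Pow I. a j * ((-1) ^ card S * \<Phi> j (shrink S q y)))"
    by (rule sum.swap)
  finally show "sieve_op I q (\<lambda>y. \<Sum>j\<in>T. a j * \<Phi> j y) y = (\<Sum>j\<in>T. a j * sieve_op I q (\<Phi> j) y)"
    by (simp add: sieve_op_def sum_distrib_left)
qed

lemma sieve_op_diff:
  "sieve_op I q (\<lambda>y. \<Phi> y - \<Psi> y) = (\<lambda>y. sieve_op I q \<Phi> y - sieve_op I q \<Psi> y)"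
  by (rule ext) (simp add: sieve_op_def algebra_simps sum_subtractf)

lemma local_op_sum:
  "local_op I q (\<lambda>y. \<Sum>j\<in>T. a j * \<Phi> j y) = (\<lambda>y. \<Sum>j\<in>T. a j * local_op I q (\<Phi> j) y)"
  by (rule ext)
    (simp add: local_op_def sieve_op_sum right_diff_distrib sum_subtractf sum_distrib_left mult_ac)

lemma local_op_diff:
  "local_op I q (\<lambda>y. \<Phi> y - \<Psi> y) = (\<lambda>y. local_op I q \<Phi> y - local_op I q \<Psi> y)"
  by (rule ext) (simp add: local_op_def sieve_op_diff algebra_simps)

lemma euler_op_sum:
  "euler_op I N (\<lambda>y. \<Sum>j\<in>T. a j * \<Phi> j y) = (\<lambda>y. \<Sum>j\<in>T. a j * euler_op I N (\<Phi> j) y)"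
  by (induction N) (simp_all add: local_op_sum)

lemma euler_op_diff:
  "euler_op I N (\<lambda>y. \<Phi> y - \<Psi> y) = (\<lambda>y. euler_op I N \<Phi> y - euler_op I N \<Psi> y)"
  by (induction N) (simp_all add: local_op_diff)

text \<open>As operators, \<open>2 * U - U\<^sup>2 - 1 = - (1 - U)\<^sup>2\<close>, and
  \<open>D\<close> is \<open>1 - U\<close>.\<close>

lemma local_op_eq:
  defines "D \<equiv> \<lambda>I q \<Phi> y. \<Phi> y - sieve_op I q \<Phi> y"
  shows "local_op I q \<Phi> y - \<Phi> y = - D I q (D I q \<Phi>) y"
  by (simp add: local_op_def D_def sieve_op_diff)

text \<open>Each \<open>T i\<close> divides the coordinate product by \<open>q\<close>, so that
  product is an eigenfunction of \<open>U\<close>. The constant \<open>c\<close> lets the rule apply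
  to its own right-hand side.\<close>

lemma sieve_op_scaled_prod:
  assumes "finite I"
  shows "sieve_op I q (\<lambda>y. c * (\<Prod>i\<in>I. y i)) =
    (\<lambda>y. (1 - 1 / real q) ^ card I * c * (\<Prod>i\<in>I. y i))"
proof
  fix y :: "'a \<Rightarrow> real"
  have "(1 - 1 / real q) ^ card I * (\<Prod>i\<in>I. y i) = (\<Prod>i\<in>I. y i - y i / q)"
    by (simp add: prod.distrib [symmetric] algebra_simps flip: prod_constant)
  also have "\<dots> = (\<Sum>S\<in>Pow I. (-1) ^ card S * (\<Prod>i\<in>S. y i / q) * (\<Prod>i\<in>I-S. y i))"
    by (rule prod_diff_conv_sum [OF assms])
  also have "\<dots> = (\<Sum>S\<in>Pow I. (-1) ^ card S * (\<Prod>i\<in>I. shrink S q y i))"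
  proof (rule sum.cong)
    fix S assume S: "S \<in> Pow I"
    hence "(\<Prod>i\<in>I. shrink S q y i) = (\<Prod>i\<in>I-S. shrink S q y i) * (\<Prod>i\<in>S. shrink S q y i)"
      using assms by (intro prod.subset_diff) auto
    thus "(-1) ^ card S * (\<Prod>i\<in>S. y i / q) * (\<Prod>i\<in>I-S. y i) =
        (-1) ^ card S * (\<Prod>i\<in>I. shrink S q y i)"
      by (simp add: shrink_def)
  qed auto
  finally show "sieve_op I q (\<lambda>y. c * (\<Prod>i\<in>I. y i)) y =
      (1 - 1 / real q) ^ card I * c * (\<Prod>i\<in>I. y i)"
    by (simp add: sieve_op_def sum_distrib_left mult_ac)
qed

lemma local_op_scaled_prod:
  assumes "finite I"
  shows "local_op I q (\<lambda>y. c * (\<Prod>i\<in>I. y i)) =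
    (\<lambda>y. (1 - 1 / real q) ^ card I * (2 - (1 - 1 / real q) ^ card I) * c * (\<Prod>i\<in>I. y i))"
  unfolding local_op_def sieve_op_scaled_prod[OF assms] by (rule ext) (simp add: algebra_simps)

definition euler_factor :: "nat \<Rightarrow> nat \<Rightarrow> real" where
  "euler_factor r p = (if prime p then (1 - 1 / real p) ^ r * (2 - (1 - 1 / real p) ^ r) else 1)"

lemma euler_op_prod:
  assumes "finite I"
  shows "euler_op I N (\<lambda>y. \<Prod>i\<in>I. y i) =
    (\<lambda>y. (\<Prod>p\<le>N. euler_factor (card I) p) * (\<Prod>i\<in>I. y i))"
proof (induction N)
  case 0
  then show ?case by (simp add: euler_factor_def)
next
  case (Suc N)
  show ?case
  proof (cases "prime (Suc N)")
    case True
    then show ?thesis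
      unfolding euler_op.simps Suc local_op_scaled_prod[OF assms]
      by (simp add: euler_factor_def mult_ac)
  next
    case False
    then show ?thesis using Suc by (simp add: euler_factor_def)
  qed
qed

subsection \<open>Operator bounds\<close>

text \<open>Two exponents, because \<open>s\<close> serves small coordinates and \<open>t\<close>
  large ones; shrinking drives coordinates below 1, so both ranges occur.\<close>

definition weight :: "'i set \<Rightarrow> real \<Rightarrow> real \<Rightarrow> ('i \<Rightarrow> real) \<Rightarrow> real" where
  "weight I s t y = (\<Prod>i\<in>I. y i powr s + y i powr t)"

lemma weight_nonneg: "weight I s t y \<ge> 0"
  by (auto simp: weight_def intro!: prod_nonneg)

text \<open>Each shrunk coordinate gains \<open>q powr (-s)\<close>, the exponent \<open>t\<close>
  gaining at least as much. A nonempty \<open>S\<close> supplies one such factor, and further ones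
  are at most 1.\<close>

lemma weight_shrink:
  assumes "finite I" "S \<subseteq> I" "S \<noteq> {}" "q \<ge> 1" "0 < s" "s \<le> t" "\<forall>i\<in>I. y i > 0"
  shows "weight I s t (shrink S q y) \<le> real q powr (-s) * weight I s t y"
proof -
  have qs: "real q powr (-s) \<le> 1" "real q powr (-s) \<ge> 0" "real q powr (-t) \<le> real q powr (-s)"
    using assms by (auto intro: powr_mono simp: powr_minus divide_simps ge_one_powr_ge_zero)
  define e where "e i = (if i \<in> S then real q powr (-s) else 1)" for i
  have "weight I s t (shrink S q y) \<le> (\<Prod>i\<in>I. e i * (y i powr s + y i powr t))"
    unfolding weight_def
  proof (intro prod_mono conjI)
    fix i assume i: "i \<in> I"
    show "shrink S q y i powr s + shrink S q y i powr t \<le> e i * (y i powr s + y i powr t)"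
    proof (cases "i \<in> S")
      case True
      have "shrink S q y i powr s + shrink S q y i powr t =
          real q powr (-s) * y i powr s + real q powr (-t) * y i powr t"
        using True assms i by (simp add: shrink_def powr_divide powr_minus field_simps)
      also have "\<dots> \<le> real q powr (-s) * y i powr s + real q powr (-s) * y i powr t"
        using qs by (intro add_left_mono mult_right_mono) auto
      finally show ?thesis using True by (simp add: e_def algebra_simps)
    qed (simp add: e_def shrink_def)
  qed auto
  also have "\<dots> = (\<Prod>i\<in>I. e i) * weight I s t y"
    by (simp add: prod.distrib weight_def)
  also have "(\<Prod>i\<in>I. e i) = (real q powr (-s)) ^ card S"
    using assms by (simp add: e_def prod.If_cases Int_absorb1)
  also have "\<dots> * weight I s t y \<le> real q powr (-s) * weight I s t y"
  proof (intro mult_right_mono weight_nonneg)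
    have "card S \<ge> 1"
      using assms by (metis One_nat_def Suc_leI card_gt_0_iff finite_subset)
    thus "(real q powr (-s)) ^ card S \<le> real q powr (-s)"
      using power_decreasing[of 1 "card S" "real q powr (-s)"] qs by simp
  qed
  finally show ?thesis .
qed

definition dominated :: "'i set \<Rightarrow> real \<Rightarrow> real \<Rightarrow> real \<Rightarrow> (('i \<Rightarrow> real) \<Rightarrow> real) \<Rightarrow> bool" where
  "dominated I s t B \<Phi> \<longleftrightarrow> (\<forall>y. (\<forall>i\<in>I. y i > 0) \<longrightarrow> \<bar>\<Phi> y\<bar> \<le> B * weight I s t y)"

lemma dominated_mono: "dominated I s t B \<Phi> \<Longrightarrow> B \<le> B' \<Longrightarrow> dominated I s t B' \<Phi>"
  unfolding dominated_def by (meson mult_right_mono order_trans weight_nonneg)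

text \<open>The term for \<open>S = {}\<close> reproduces \<open>\<Phi>\<close> and cancels; fewer
  than \<open>2 ^ card I\<close> terms remain, each smaller by \<open>q powr (-s)\<close>.\<close>

lemma dominated_sieve_defect:
  assumes "finite I" "q \<ge> 1" "0 < s" "s \<le> t" "B \<ge> 0" and dom: "dominated I s t B \<Phi>"
  shows "dominated I s t (2 ^ card I * real q powr (-s) * B) (\<lambda>y. \<Phi> y - sieve_op I q \<Phi> y)"
  unfolding dominated_def
proof (intro allI impI)
  fix y :: "'a \<Rightarrow> real" assume y: "\<forall>i\<in>I. y i > 0"
  let ?B = "B * (real q powr (-s) * weight I s t y)"
  have "sieve_op I q \<Phi> y = (\<Sum>S\<in>Pow I - {{}}. (-1) ^ card S * \<Phi> (shrink S q y)) + \<Phi> y"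
    using assms by (simp add: sieve_op_def sum.remove[of "Pow I" "{}"])
  hence "\<bar>\<Phi> y - sieve_op I q \<Phi> y\<bar> = \<bar>\<Sum>S\<in>Pow I - {{}}. (-1) ^ card S * \<Phi> (shrink S q y)\<bar>"
    by simp
  also have "\<dots> \<le> (\<Sum>S\<in>Pow I - {{}}. ?B)"
  proof (rule order_trans[OF sum_abs sum_mono])
    fix S assume S: "S \<in> Pow I - {{}}"
    have "\<bar>(-1) ^ card S * \<Phi> (shrink S q y)\<bar> = \<bar>\<Phi> (shrink S q y)\<bar>"
      by (simp add: abs_mult power_abs)
    also have "\<dots> \<le> B * weight I s t (shrink S q y)"
      using dom shrink_pos[of q I y S] y assms unfolding dominated_def by simp
    also have "\<dots> \<le> ?B"
      using weight_shrink[of I S q s t y] assms y S by (intro mult_left_mono) auto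
    finally show "\<bar>(-1) ^ card S * \<Phi> (shrink S q y)\<bar> \<le> ?B" .
  qed
  also have "\<dots> \<le> (\<Sum>S\<in>Pow I. ?B)"
    using assms weight_nonneg[of I s t y] by (intro sum_mono2) auto
  also have "\<dots> = 2 ^ card I * real q powr (-s) * B * weight I s t y"
    using assms by (simp add: card_Pow)
  finally show "\<bar>\<Phi> y - sieve_op I q \<Phi> y\<bar> \<le> 2 ^ card I * real q powr (-s) * B * weight I s t y" .
qed

text \<open>The defect is quadratic in the sieve defect, which gives \<open>q powr (- 2 * s)\<close>,
  summable for \<open>s > 1 / 2\<close>; this is the source of the exponent \<open>r - 1 / 2\<close>.\<close>

lemma dominated_local_defect:
  assumes "finite I" "q \<ge> 1" "0 < s" "s \<le> t" "B \<ge> 0" and dom: "dominated I s t B \<Phi>"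
  shows "dominated I s t (4 ^ card I * real q powr (-2 * s) * B) (\<lambda>y. local_op I q \<Phi> y - \<Phi> y)"
proof -
  have "dominated I s t (2 ^ card I * real q powr (-s) * (2 ^ card I * real q powr (-s) * B))
      (\<lambda>y. (\<Phi> y - sieve_op I q \<Phi> y) - sieve_op I q (\<lambda>y. \<Phi> y - sieve_op I q \<Phi> y) y)"
    using assms by (intro dominated_sieve_defect) auto
  moreover have "2 ^ card I * real q powr (-s) * (2 ^ card I * real q powr (-s) * B) =
      4 ^ card I * real q powr (-2 * s) * B"
  proof -
    have "(4::real) ^ card I = 2 ^ card I * 2 ^ card I"
      by (simp flip: power_mult_distrib)
    moreover have "real q powr (-2 * s) = real q powr (-s) * real q powr (-s)"
      by (simp flip: powr_add)
    ultimately show ?thesis by simp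
  qed
  ultimately show ?thesis
    unfolding dominated_def local_op_eq abs_minus_cancel by simp
qed

definition defect_coeff :: "nat \<Rightarrow> real \<Rightarrow> nat \<Rightarrow> real" where
  "defect_coeff r s q = 4 ^ r * real q powr (-2 * s)"

lemma defect_coeff_nonneg: "defect_coeff r s q \<ge> 0"
  by (simp add: defect_coeff_def)

lemma summable_defect_coeff: "s > 1/2 \<Longrightarrow> summable (defect_coeff r s)"
  unfolding defect_coeff_def by (intro summable_mult) (simp add: summable_real_powr_iff)

text \<open>Each prime costs a factor \<open>1 + e k \<le> exp (e k)\<close> with \<open>e\<close>
  the defect coefficient, whose series converges for \<open>s > 1/2\<close>; hence a bound free of
  \<open>N\<close>.\<close>

lemma dominated_euler_op:
  assumes "finite I" "1/2 < s" "s \<le> t" "B \<ge> 0" and dom: "dominated I s t B \<Phi>"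
  shows "dominated I s t (exp (suminf (defect_coeff (card I) s)) * B) (euler_op I N \<Phi>)"
proof -
  let ?e = "defect_coeff (card I) s"
  \<comment> \<open>The induction needs partial sums, which absorb one factor per step; the full
    series enters only at the end.\<close>
  have "dominated I s t (exp (\<Sum>k\<le>N. ?e k) * B) (euler_op I N \<Phi>)"
  proof (induction N)
    case 0
    have "exp (?e 0) * B \<ge> 1 * B"
      using defect_coeff_nonneg[of "card I" s 0] assms(4) by (intro mult_right_mono) auto
    thus ?case
      using dominated_mono[OF dom] by simp
  next
    case (Suc N)
    let ?E = "exp (\<Sum>k\<le>N. ?e k) * B"
    have mono: "(1 + ?e (Suc N)) * ?E \<le> exp (\<Sum>k\<le>Suc N. ?e k) * B"
    proof -
      have "(1 + ?e (Suc N)) * ?E \<le> exp (?e (Suc N)) * ?E"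
        using assms(4) by (intro mult_right_mono exp_ge_add_one_self) auto
      thus ?thesis by (simp add: exp_add mult_ac)
    qed
    have "dominated I s t ((1 + ?e (Suc N)) * ?E) (euler_op I (Suc N) \<Phi>)"
    proof (cases "prime (Suc N)")
      case True
      have D: "dominated I s t (?e (Suc N) * ?E)
          (\<lambda>y. local_op I (Suc N) (euler_op I N \<Phi>) y - euler_op I N \<Phi> y)"
        unfolding defect_coeff_def[of _ _ "Suc N"] using assms Suc
        by (intro dominated_local_defect) auto
      show ?thesis unfolding dominated_def
      proof (intro allI impI)
        fix y :: "'a \<Rightarrow> real" assume y: "\<forall>i\<in>I. y i > 0"
        show "\<bar>euler_op I (Suc N) \<Phi> y\<bar> \<le> (1 + ?e (Suc N)) * ?E * weight I s t y"
          using D[unfolded dominated_def, rule_format, of y] Suc[unfolded dominated_def, rule_format, of y] y True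
          by (simp add: distrib_right)
      qed
    next
      case False
      have "1 * ?E \<le> (1 + ?e (Suc N)) * ?E"
        using assms(4) defect_coeff_nonneg[of "card I" s "Suc N"] by (intro mult_right_mono) auto
      with False show ?thesis
        using dominated_mono[OF Suc] by simp
    qed
    thus ?case
      using mono by (rule dominated_mono)
  qed
  moreover have "(\<Sum>k\<le>N. ?e k) \<le> suminf ?e"
    using assms by (intro sum_le_suminf summable_defect_coeff) (auto simp: defect_coeff_nonneg)
  hence "exp (\<Sum>k\<le>N. ?e k) * B \<le> exp (suminf ?e) * B"
    using assms by (intro mult_right_mono) auto
  ultimately show ?thesis
    by (rule dominated_mono)
qed

text \<open>Consecutive terms differ by a local defect of a function bounded uniformly in
  \<open>N\<close>, so the telescoping series is dominated by \<open>defect_coeff\<close>.\<close>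

lemma convergent_euler_op:
  assumes "finite I" "1/2 < s" "s \<le> t" "B \<ge> 0" and dom: "dominated I s t B \<Phi>"
    and y: "\<forall>i\<in>I. y i > 0"
  shows "convergent (\<lambda>N. euler_op I N \<Phi> y)"
proof -
  let ?e = "defect_coeff (card I) s" and ?E = "exp (suminf (defect_coeff (card I) s)) * B"
  have "summable (\<lambda>N. euler_op I (Suc N) \<Phi> y - euler_op I N \<Phi> y)"
  proof (rule summable_comparison_test)
    show "summable (\<lambda>N. ?e (Suc N) * (?E * weight I s t y))"
      using summable_defect_coeff[OF assms(2)] by (intro summable_mult2) (simp add: summable_Suc_iff)
    show "\<exists>M. \<forall>N\<ge>M. norm (euler_op I (Suc N) \<Phi> y - euler_op I N \<Phi> y) \<le> ?e (Suc N) * (?E * weight I s t y)"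
    proof (intro exI allI impI)
      fix N :: nat
      have "dominated I s t (?e (Suc N) * ?E)
          (\<lambda>y. local_op I (Suc N) (euler_op I N \<Phi>) y - euler_op I N \<Phi> y)"
        unfolding defect_coeff_def[of _ _ "Suc N"] using assms
        by (intro dominated_local_defect dominated_euler_op) auto
      thus "norm (euler_op I (Suc N) \<Phi> y - euler_op I N \<Phi> y) \<le> ?e (Suc N) * (?E * weight I s t y)"
        using y weight_nonneg[of I s t y] assms defect_coeff_nonneg[of "card I" s "Suc N"]
        by (auto simp: dominated_def mult.assoc)
    qed
  qed
  hence "convergent (\<lambda>n. \<Sum>N<n. euler_op I (Suc N) \<Phi> y - euler_op I N \<Phi> y)"
    by (simp add: summable_iff_convergent)
  hence "convergent (\<lambda>n. euler_op I n \<Phi> y - euler_op I 0 \<Phi> y)"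
    by (simp only: sum_lessThan_telescope[of "\<lambda>N. euler_op I N \<Phi> y"])
  thus ?thesis by (simp only: convergent_diff_const_right_iff)
qed

subsection \<open>The Dirichlet divisor problem\<close>

definition divisor_sum :: "real \<Rightarrow> real" where
  "divisor_sum y = (\<Sum>n | 1 \<le> n \<and> real n \<le> y. real (card {d. d dvd n}))"

text \<open>A divisor \<open>d\<close> of \<open>n\<close> corresponds to the lattice point
  \<open>(d, n div d)\<close> under the hyperbola.\<close>

lemma sum_card_divisors:
  "(\<Sum>n=1..m. card {d. d dvd n}) = card {(a, b). 1 \<le> a \<and> 1 \<le> b \<and> a * b \<le> (m::nat)}"
proof -
  have "card (SIGMA n:{1..m}. {d. d dvd n}) = card {(a, b). 1 \<le> a \<and> 1 \<le> b \<and> a * b \<le> m}"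
    by (rule bij_betw_same_card[of "\<lambda>(n, d). (d, n div d)"],
        rule bij_betwI[where g = "\<lambda>(a, b). (a * b, a)"]) (auto simp: Suc_le_eq intro: Nat.gr0I)
  thus ?thesis by (subst (asm) card_SigmaI) auto
qed

text \<open>Since \<open>u\<close> is the integer square root of \<open>m\<close>, every lattice
  point has \<open>a \<le> u\<close> or \<open>b \<le> u\<close>. The two halves are mirror images
  and overlap in the square of side \<open>u\<close>, which stands on the left to avoid truncated
  subtraction.\<close>

lemma hyperbola_card:
  fixes u m :: nat
  assumes "u ^ 2 \<le> m" "m < (u + 1) ^ 2"
  shows "card {(a, b). 1 \<le> a \<and> 1 \<le> b \<and> a * b \<le> m} + u ^ 2 = 2 * (\<Sum>a=1..u. m div a)"
proof -
  define A where "A = (SIGMA a:{1..u}. {1..m div a})"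
  define B where "B = (\<lambda>(a, b). (b, a)) ` A"
  have fin: "finite A" "finite B" by (auto simp: A_def B_def)
  have cA: "card A = (\<Sum>a=1..u. m div a)" by (simp add: A_def)
  have cB: "card B = card A" unfolding B_def by (intro card_image) (auto simp: inj_on_def)
  have memA: "(a, b) \<in> A \<longleftrightarrow> 1 \<le> a \<and> a \<le> u \<and> 1 \<le> b \<and> a * b \<le> m" for a b
    by (auto simp: A_def less_eq_div_iff_mult_less_eq mult.commute)
  have memB: "(a, b) \<in> B \<longleftrightarrow> (b, a) \<in> A" for a b by (force simp: B_def)
  have "A \<inter> B = {1..u} \<times> {1..u}"
  proof (intro set_eqI, clarify)
    fix a b
    have "a * b \<le> m" if "a \<le> u" "b \<le> u"
      using mult_le_mono[OF that] assms(1) by (simp add: power2_eq_square)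
    thus "(a, b) \<in> A \<inter> B \<longleftrightarrow> (a, b) \<in> {1..u} \<times> {1..u}" by (auto simp: memA memB mult.commute)
  qed
  hence int: "card (A \<inter> B) = u ^ 2" by (simp add: power2_eq_square)
  have "A \<union> B = {(a, b). 1 \<le> a \<and> 1 \<le> b \<and> a * b \<le> m}"
  proof (intro set_eqI, clarify)
    fix a b
    have "a \<le> u \<or> b \<le> u" if "a * b \<le> m"
    proof (rule ccontr)
      assume "\<not> (a \<le> u \<or> b \<le> u)"
      hence "(u + 1) * (u + 1) \<le> a * b" by (intro mult_le_mono) auto
      thus False using that assms(2) by (simp add: power2_eq_square)
    qed
    thus "(a, b) \<in> A \<union> B \<longleftrightarrow> (a, b) \<in> {(a, b). 1 \<le> a \<and> 1 \<le> b \<and> a * b \<le> m}"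
      by (auto simp: memA memB mult.commute)
  qed
  with card_Un_Int[OF fin] cA cB int show ?thesis by simp
qed

lemma harm_approx:
  assumes "u \<ge> 1"
  shows "\<bar>harm u - ln (real u + 1) - euler_mascheroni\<bar> \<le> 1 / (2 * real u)"
proof -
  obtain n where u: "u = Suc n" using assms by (cases u) auto
  have "harm (Suc n) - ln (real (n + 2)) \<le> euler_mascheroni"
    by (rule order_trans[OF _ euler_mascheroni_lower[of n]]) simp
  with euler_mascheroni_upper[of n] show ?thesis
    by (simp add: u add_ac abs_if)
qed

text \<open>Hyperbola method: rounding the quotients costs \<open>4 * sqrt y\<close>, the harmonic
  sum \<open>4 * sqrt y\<close>, and replacing \<open>u\<^sup>2\<close> by \<open>y\<close> another
  \<open>2 * sqrt y\<close>; the constant 14 leaves room.\<close>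

lemma divisor_sum_approx:
  fixes y :: real
  assumes y: "y \<ge> 1"
  shows "\<bar>divisor_sum y - y * (ln y + (2 * euler_mascheroni - 1))\<bar> \<le> 14 * sqrt y"
proof -
  define m where "m = nat \<lfloor>y\<rfloor>"
  define u where "u = nat \<lfloor>sqrt y\<rfloor>"
  define g where "g = (euler_mascheroni :: real)"
  have m: "real m \<le> y" "y < real m + 1" using y by (auto simp: m_def)
  have sy: "sqrt y \<ge> 1" "sqrt y * sqrt y = y" using y by auto
  have u: "real u \<le> sqrt y" "sqrt y < real u + 1" "u \<ge> 1"
    using sy by (auto simp: u_def le_nat_iff)
  have "real (u ^ 2) \<le> y" using mult_mono[OF u(1) u(1)] sy by (simp add: power2_eq_square)
  hence um: "u ^ 2 \<le> m" using m by linarith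
  have "y < real ((u + 1) ^ 2)"
    using mult_strict_mono[OF u(2) u(2)] sy by (simp add: power2_eq_square algebra_simps)
  hence mu: "m < (u + 1) ^ 2" using m by linarith
  have set: "{n. 1 \<le> n \<and> real n \<le> y} = {1..m}" using y by (auto simp: m_def le_nat_iff le_floor_iff)
  have "divisor_sum y = real (\<Sum>n=1..m. card {d. d dvd n})"
    unfolding divisor_sum_def set by simp
  also have "\<dots> = 2 * (\<Sum>a=1..u. real (m div a)) - real u ^ 2"
    using hyperbola_card[OF um mu] unfolding sum_card_divisors
    by (simp flip: of_nat_sum of_nat_power)
  finally have D: "divisor_sum y = 2 * (\<Sum>a=1..u. real (m div a)) - real u ^ 2" .
  \<comment> \<open>Per term, one unit covers \<open>y\<close> against \<open>m\<close> and the
    other the integer division.\<close>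
  have "\<bar>(\<Sum>a=1..u. real (m div a)) - (\<Sum>a=1..u. y / a)\<bar> \<le> (\<Sum>a=1..u. 2)"
    unfolding sum_subtractf [symmetric]
  proof (rule order_trans[OF sum_abs sum_mono])
    fix a assume a: "a \<in> {1..u}"
    have "real (m div a) \<le> real m / a" by (rule of_nat_div_le_of_nat)
    also have "\<dots> \<le> y / a" using m by (intro divide_right_mono) auto
    finally have 1: "real (m div a) \<le> y / a" .
    have "y / a \<le> (real m + 1) / a" using m by (intro divide_right_mono) auto
    also have "\<dots> \<le> real m / a + 1" using a by (simp add: field_simps)
    also have "real m / a \<le> real (m div a) + 1"
    proof -
      have "m \<le> a + a * (m div a)" using a dividend_less_times_div[of a m] by simp
      hence "real m \<le> real (a + a * (m div a))" by (rule of_nat_mono)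
      thus ?thesis using a by (simp add: field_simps)
    qed
    finally show "\<bar>real (m div a) - y / a\<bar> \<le> 2" using 1 by simp
  qed
  hence S: "\<bar>(\<Sum>a=1..u. real (m div a)) - y * harm u\<bar> \<le> 2 * u"
    by (simp add: harm_def sum_distrib_left divide_inverse)
  \<comment> \<open>\<open>harm_approx\<close> compares \<open>harm u\<close> with
    \<open>ln (u + 1)\<close>; the next steps move the logarithm to \<open>sqrt y\<close> at a cost
    of \<open>1 / sqrt y\<close>.\<close>
  define h where "h = harm u - ln (sqrt y) - g"
  have lnu: "ln (real u + 1) - ln (sqrt y) \<ge> 0" using u sy by simp
  have "ln (real u + 1) - ln (sqrt y) = ln ((real u + 1) / sqrt y)"
    using sy u by (subst ln_div) auto
  also have "\<dots> \<le> (real u + 1) / sqrt y - 1" using sy u by (intro ln_le_minus_one) auto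
  also have "\<dots> \<le> (sqrt y + 1) / sqrt y - 1"
    using u sy by (intro diff_right_mono divide_right_mono) auto
  also have "(sqrt y + 1) / sqrt y - 1 = 1 / sqrt y" using y by (simp add: add_divide_distrib)
  finally have lnu': "ln (real u + 1) - ln (sqrt y) \<le> 1 / sqrt y" .
  have "1 / (2 * real u) \<le> 1 / sqrt y"
  proof (rule frac_le)
    show "sqrt y \<le> 2 * real u" using u by linarith
  qed (use sy in auto)
  moreover have "2 / sqrt y = 1 / sqrt y + 1 / sqrt y" by simp
  ultimately have h: "\<bar>h\<bar> \<le> 2 / sqrt y"
    using harm_approx[OF u(3)] lnu lnu' unfolding h_def g_def abs_le_iff by linarith
  have "\<bar>y * h\<bar> \<le> y * (2 / sqrt y)" using mult_left_mono[OF h, of y] y by (simp add: abs_mult)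
  also have "\<dots> = 2 * sqrt y" using sy by (simp add: field_simps)
  finally have yh: "\<bar>y * h\<bar> \<le> 2 * sqrt y" .
  have "\<bar>real u ^ 2 - y\<bar> \<le> 2 * sqrt y"
  proof -
    have "(sqrt y - 1) * (sqrt y - 1) \<le> real u * real u" using u sy by (intro mult_mono) auto
    hence "y - real u ^ 2 \<le> 2 * sqrt y" using sy by (simp add: algebra_simps power2_eq_square)
    moreover have "real u ^ 2 \<le> y" using \<open>real (u ^ 2) \<le> y\<close> by simp
    ultimately show ?thesis using sy by (simp add: abs_le_iff)
  qed
  \<comment> \<open>Uses \<open>2 * ln (sqrt y) = ln y\<close>; the final \<open>- y\<close> is
    matched with \<open>- u\<^sup>2\<close>.\<close>
  moreover have "y * (ln y + (2 * g - 1)) = 2 * (y * harm u) - 2 * (y * h) - y"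
    using y by (simp add: h_def ln_sqrt algebra_simps)
  ultimately show ?thesis
    using S yh u D sy unfolding g_def abs_le_iff by linarith
qed

definition divisor_main :: "real \<Rightarrow> real" where
  "divisor_main y = y * (ln y + (2 * euler_mascheroni - 1))"

text \<open>The logarithm costs \<open>y powr \<delta>\<close> above 1 and
  \<open>y powr (-\<delta>)\<close> below 1. In the latter range \<open>\<delta> \<le> 1/4\<close>
  gives \<open>1 - \<delta> \<ge> 1/2 + \<delta>\<close>, and powers of \<open>y\<close> decrease in
  the exponent.\<close>

lemma divisor_main_bound:
  assumes "0 < \<delta>" "\<delta> \<le> 1/4" "y > 0"
  shows "\<bar>divisor_main y\<bar> \<le> (1 / \<delta> + \<bar>2 * euler_mascheroni - 1\<bar>) * (if y \<ge> 1 then y powr (1 + \<delta>) else y powr (1/2 + \<delta>))"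
proof (cases "y \<ge> 1")
  case True
  let ?c = "2 * euler_mascheroni - 1 :: real"
  have "\<bar>ln y\<bar> \<le> y powr \<delta> / \<delta>" using ln_powr_bound[OF True assms(1)] True by simp
  moreover have "\<bar>?c\<bar> \<le> \<bar>?c\<bar> * y powr \<delta>"
    using mult_left_mono[of 1 "y powr \<delta>" "\<bar>?c\<bar>"] True assms by (simp add: ge_one_powr_ge_zero)
  ultimately have "\<bar>ln y + ?c\<bar> \<le> (1 / \<delta> + \<bar>?c\<bar>) * y powr \<delta>" by (simp add: algebra_simps)
  hence "y * \<bar>ln y + ?c\<bar> \<le> y * ((1 / \<delta> + \<bar>?c\<bar>) * y powr \<delta>)" using assms by simp
  thus ?thesis using True assms by (simp add: divisor_main_def abs_mult powr_add mult_ac)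
next
  case False
  let ?c = "2 * euler_mascheroni - 1 :: real"
  have "ln (1 / y) \<le> (1 / y) powr \<delta> / \<delta>" using False assms by (intro ln_powr_bound) auto
  hence "\<bar>ln y\<bar> \<le> y powr (-\<delta>) / \<delta>"
    using False assms by (simp add: ln_div powr_divide powr_minus field_simps)
  moreover have "1 \<le> y powr (-\<delta>)"
    using powr_mono'[of "-\<delta>" 0 y] False assms by simp
  hence "\<bar>?c\<bar> \<le> \<bar>?c\<bar> * y powr (-\<delta>)"
    using mult_left_mono[of 1 "y powr (-\<delta>)" "\<bar>?c\<bar>"] by simp
  ultimately have "\<bar>ln y + ?c\<bar> \<le> (1 / \<delta> + \<bar>?c\<bar>) * y powr (-\<delta>)" by (simp add: algebra_simps)
  hence "y * \<bar>ln y + ?c\<bar> \<le> y * ((1 / \<delta> + \<bar>?c\<bar>) * y powr (-\<delta>))" using assms by simp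
  also have "\<dots> = (1 / \<delta> + \<bar>?c\<bar>) * y powr (1 - \<delta>)"
    using assms by (simp add: powr_diff powr_minus field_simps)
  also have "\<dots> \<le> (1 / \<delta> + \<bar>?c\<bar>) * y powr (1/2 + \<delta>)"
    using assms False by (intro mult_left_mono powr_mono') auto
  finally show ?thesis using False assms by (simp add: divisor_main_def abs_mult)
qed

text \<open>Bounds on all of \<open>y > 0\<close>, since the operators shrink arguments below 1.
  There the divisor sum is empty and the difference is the main term alone.\<close>

lemma divisor_sum_bounds:
  assumes "0 < \<delta>" "\<delta> \<le> 1/4"
  obtains K where "K \<ge> 1"
    "\<And>y. y > 0 \<Longrightarrow> \<bar>divisor_main y\<bar> \<le> K * (y powr (1/2 + \<delta>) + y powr (1 + \<delta>))"
    "\<And>y. y > 0 \<Longrightarrow> \<bar>divisor_sum y - divisor_main y\<bar> \<le> K * y powr (1/2 + \<delta>)"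
proof -
  define K0 where "K0 = 1 / \<delta> + \<bar>2 * euler_mascheroni - 1 :: real\<bar>"
  define K where "K = max K0 14"
  have K: "K \<ge> 14" "K \<ge> K0" "K0 \<ge> 0" using assms by (auto simp: K_def K0_def)
  have main: "\<bar>divisor_main y\<bar> \<le> K * (y powr (1/2 + \<delta>) + y powr (1 + \<delta>))" if "y > 0" for y
  proof -
    have "\<bar>divisor_main y\<bar> \<le> K0 * (if y \<ge> 1 then y powr (1 + \<delta>) else y powr (1/2 + \<delta>))"
      unfolding K0_def by (rule divisor_main_bound) (use assms that in auto)
    also have "\<dots> \<le> K * (y powr (1/2 + \<delta>) + y powr (1 + \<delta>))"
      using K by (intro mult_mono) auto
    finally show ?thesis .
  qed
  have diff: "\<bar>divisor_sum y - divisor_main y\<bar> \<le> K * y powr (1/2 + \<delta>)" if "y > 0" for y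
  proof (cases "y \<ge> 1")
    case True
    have "\<bar>divisor_sum y - divisor_main y\<bar> \<le> 14 * y powr (1/2)"
      using divisor_sum_approx[OF True] that by (simp add: divisor_main_def powr_half_sqrt)
    also have "\<dots> \<le> K * y powr (1/2 + \<delta>)"
      using K True assms by (intro mult_mono powr_mono) auto
    finally show ?thesis .
  next
    case False
    hence empty: "{n. 1 \<le> n \<and> real n \<le> y} = {}" by force
    have "divisor_sum y = 0" unfolding divisor_sum_def empty by simp
    hence "\<bar>divisor_sum y - divisor_main y\<bar> \<le> K0 * y powr (1/2 + \<delta>)"
      using divisor_main_bound[OF assms that] False by (simp add: K0_def)
    also have "\<dots> \<le> K * y powr (1/2 + \<delta>)" using K by (intro mult_right_mono) auto
    finally show ?thesis .
  qed
  show thesis by (rule that[of K]) (use K main diff in auto)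
qed

subsection \<open>Summation over boxes\<close>

definition box :: "'i set \<Rightarrow> real \<Rightarrow> ('i \<Rightarrow> real) \<Rightarrow> ('i \<Rightarrow> nat) set" where
  "box I x y = (\<Pi>\<^sub>E i\<in>I. {m. 1 \<le> m \<and> real m \<le> x * y i})"

lemma finite_box: "finite I \<Longrightarrow> finite (box I x y)"
proof -
  assume I: "finite I"
  have "finite {m. 1 \<le> m \<and> real m \<le> x * y i}" for i
    by (rule finite_subset[of _ "{..nat \<lfloor>x * y i\<rfloor>}"]) (auto simp: le_nat_iff le_floor_iff)
  thus ?thesis unfolding box_def by (intro finite_PiE I)
qed

text \<open>Counterpart of \<open>shrink\<close> on summation indices: it maps the box shrunk on
  \<open>S\<close> to the tuples of the full box whose coordinates in \<open>S\<close> are multiples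
  of \<open>q\<close>.\<close>

definition dilate :: "'i set \<Rightarrow> nat \<Rightarrow> ('i \<Rightarrow> nat) \<Rightarrow> 'i \<Rightarrow> nat" where
  "dilate S q n = (\<lambda>i. if i \<in> S then q * n i else n i)"

text \<open>After dilation the sums over shrunk boxes become sums over multiples of \<open>q\<close>
  in one box, and the signed sum over \<open>S\<close> factors coordinatewise. The weight
  \<open>c\<close> passes through because it does not notice factors \<open>q\<close>.\<close>

lemma sieve_op_box_sum:
  fixes c :: "('i \<Rightarrow> nat) \<Rightarrow> real" and g :: "nat \<Rightarrow> real"
  assumes I: "finite I" and q: "q > 0" and c: "\<And>S n. S \<subseteq> I \<Longrightarrow> c (dilate S q n) = c n"
  shows "sieve_op I q (\<lambda>y. \<Sum>n\<in>box I x y. c n * (\<Prod>i\<in>I. g (n i))) y =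
    (\<Sum>n\<in>box I x y. c n * (\<Prod>i\<in>I. g (n i) - (if q dvd n i then g (n i div q) else 0)))"
proof -
  define g' where "g' m = (if q dvd m then g (m div q) else 0)" for m
  have eq: "(\<Sum>n\<in>box I x y. c n * ((\<Prod>i\<in>S. g' (n i)) * (\<Prod>i\<in>I-S. g (n i)))) =
      (\<Sum>n\<in>box I x (shrink S q y). c n * (\<Prod>i\<in>I. g (n i)))" if S: "S \<subseteq> I" for S
  proof -
    have finS: "finite S" using S I finite_subset by blast
    have inj: "inj_on (dilate S q) (box I x (shrink S q y))"
    proof (rule inj_onI, rule ext)
      fix m n i assume "dilate S q m = dilate S q n"
      hence "dilate S q m i = dilate S q n i" by simp
      thus "m i = n i" using q by (auto simp: dilate_def split: if_splits)
    qed
    have sub: "dilate S q ` box I x (shrink S q y) \<subseteq> box I x y"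
    proof
      fix n assume "n \<in> dilate S q ` box I x (shrink S q y)"
      then obtain m where m: "m \<in> box I x (shrink S q y)" "n = dilate S q m" by blast
      show "n \<in> box I x y" unfolding box_def
      proof (rule PiE_I)
        fix i assume i: "i \<in> I"
        have "1 \<le> m i" "real (m i) \<le> x * shrink S q y i" using m(1) i by (auto simp: box_def PiE_def Pi_def)
        thus "n i \<in> {m. 1 \<le> m \<and> real m \<le> x * y i}"
          using q unfolding m(2) by (auto simp: dilate_def shrink_def field_simps Suc_le_eq)
      next
        fix i assume "i \<notin> I"
        thus "n i = undefined" using m S by (auto simp: dilate_def box_def)
      qed
    qed
    \<comment> \<open>A nonzero product forces \<open>q dvd n i\<close> on \<open>S\<close>;
      dividing these coordinates by \<open>q\<close> exhibits \<open>n\<close> as a dilate.\<close>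
    have zero: "(\<Prod>i\<in>S. g' (n i)) = 0" if n: "n \<in> box I x y - dilate S q ` box I x (shrink S q y)" for n
    proof (rule ccontr)
      assume "(\<Prod>i\<in>S. g' (n i)) \<noteq> 0"
      hence dvd: "q dvd n i" if "i \<in> S" for i
        using that finS by (auto simp: g'_def split: if_splits)
      define m where "m i = (if i \<in> S then n i div q else n i)" for i
      have "n = dilate S q m" using dvd by (auto simp: dilate_def m_def)
      moreover have "m \<in> box I x (shrink S q y)" unfolding box_def
      proof (rule PiE_I)
        fix i assume i: "i \<in> I"
        have *: "1 \<le> n i" "real (n i) \<le> x * y i" using n i by (auto simp: box_def PiE_def Pi_def)
        show "m i \<in> {m. 1 \<le> m \<and> real m \<le> x * shrink S q y i}"
        proof (cases "i \<in> S")
          case True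
          then obtain k where k: "n i = q * k" using dvd by (auto elim: dvdE)
          thus ?thesis using True * q by (auto simp: m_def shrink_def field_simps Suc_le_eq)
        qed (use * in \<open>simp add: m_def shrink_def\<close>)
      next
        fix i assume "i \<notin> I"
        thus "m i = undefined" using n S by (auto simp: m_def box_def)
      qed
      ultimately show False using n by blast
    qed
    have "(\<Sum>n\<in>box I x y. c n * ((\<Prod>i\<in>S. g' (n i)) * (\<Prod>i\<in>I-S. g (n i)))) =
        (\<Sum>n\<in>dilate S q ` box I x (shrink S q y). c n * ((\<Prod>i\<in>S. g' (n i)) * (\<Prod>i\<in>I-S. g (n i))))"
      using zero by (intro sum.mono_neutral_right finite_box I sub ballI) simp
    also have "\<dots> = (\<Sum>m\<in>box I x (shrink S q y).
        c (dilate S q m) * ((\<Prod>i\<in>S. g' (dilate S q m i)) * (\<Prod>i\<in>I-S. g (dilate S q m i))))"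
      by (simp add: sum.reindex[OF inj])
    also have "\<dots> = (\<Sum>m\<in>box I x (shrink S q y). c m * (\<Prod>i\<in>I. g (m i)))"
    proof (rule sum.cong[OF refl])
      fix m
      have "(\<Prod>i\<in>S. g' (dilate S q m i)) = (\<Prod>i\<in>S. g (m i))"
        using q by (simp add: dilate_def g'_def)
      moreover have "(\<Prod>i\<in>I-S. g (dilate S q m i)) = (\<Prod>i\<in>I-S. g (m i))"
        by (simp add: dilate_def)
      moreover have "(\<Prod>i\<in>S. g (m i)) * (\<Prod>i\<in>I-S. g (m i)) = (\<Prod>i\<in>I. g (m i))"
        using prod.subset_diff[OF S I, of "\<lambda>i. g (m i)"] by (simp add: mult.commute)
      ultimately show "c (dilate S q m) * ((\<Prod>i\<in>S. g' (dilate S q m i)) * (\<Prod>i\<in>I-S. g (dilate S q m i))) =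
          c m * (\<Prod>i\<in>I. g (m i))"
        by (simp add: c[OF S])
    qed
    finally show ?thesis .
  qed
  have "(\<Sum>n\<in>box I x y. c n * (\<Prod>i\<in>I. g (n i) - g' (n i))) =
      (\<Sum>n\<in>box I x y. \<Sum>S\<in>Pow I. (-1) ^ card S * (c n * ((\<Prod>i\<in>S. g' (n i)) * (\<Prod>i\<in>I-S. g (n i)))))"
    by (simp add: prod_diff_conv_sum[OF I] sum_distrib_left mult_ac)
  also have "\<dots> = (\<Sum>S\<in>Pow I. (-1) ^ card S *
      (\<Sum>n\<in>box I x y. c n * ((\<Prod>i\<in>S. g' (n i)) * (\<Prod>i\<in>I-S. g (n i)))))"
    by (subst sum.swap) (simp add: sum_distrib_left)
  also have "\<dots> = sieve_op I q (\<lambda>y. \<Sum>n\<in>box I x y. c n * (\<Prod>i\<in>I. g (n i))) y"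
    unfolding sieve_op_def by (intro sum.cong refl arg_cong2[of _ _ _ _ "(*)"] eq) auto
  finally show ?thesis by (simp add: g'_def)
qed

section \<open>Sieving the divisor counts by the primes up to \<open>N\<close>\<close>

definition rough_divisors :: "nat \<Rightarrow> nat \<Rightarrow> nat set" where
  "rough_divisors N n = {d. d dvd n \<and> (\<forall>p. prime p \<and> p \<le> N \<longrightarrow> \<not> p dvd d)}"

definition prime_divisors_upto :: "nat \<Rightarrow> 'i set \<Rightarrow> ('i \<Rightarrow> nat) \<Rightarrow> nat set" where
  "prime_divisors_upto N I n = {p. prime p \<and> p \<le> N \<and> p dvd (\<Prod>i\<in>I. n i)}"

lemma finite_prime_divisors_upto [simp]: "finite (prime_divisors_upto N I n)"
  by (rule finite_subset[of _ "{..N}"]) (auto simp: prime_divisors_upto_def)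

text \<open>Multiplying by a larger prime creates no prime divisor up to \<open>N\<close>. This is
  the invariance that \<open>sieve_op_box_sum\<close> asks of \<open>c\<close>.\<close>

lemma prime_divisors_upto_dilate:
  assumes "finite I" "prime q" "q > N"
  shows "prime_divisors_upto N I (dilate S q n) = prime_divisors_upto N I n"
proof -
  have "p dvd (\<Prod>i\<in>I. dilate S q n i) \<longleftrightarrow> p dvd (\<Prod>i\<in>I. n i)" if p: "prime p" "p \<le> N" for p
  proof -
    have "p \<noteq> q" using assms p by auto
    hence "\<not> p dvd q" using p assms primes_dvd_imp_eq by blast
    thus ?thesis
      using p assms by (auto simp: prime_dvd_prod_iff dilate_def prime_dvd_mult_iff split: if_splits)
  qed
  thus ?thesis unfolding prime_divisors_upto_def by blast
qed

lemma card_prime_divisors_upto_Suc: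
  "card (prime_divisors_upto (Suc N) I n) =
    card (prime_divisors_upto N I n) + (if prime (Suc N) \<and> Suc N dvd (\<Prod>i\<in>I. n i) then 1 else 0)"
proof -
  have "prime_divisors_upto (Suc N) I n = prime_divisors_upto N I n \<union>
      (if prime (Suc N) \<and> Suc N dvd (\<Prod>i\<in>I. n i) then {Suc N} else {})"
    by (auto simp: prime_divisors_upto_def le_Suc_eq)
  moreover have "Suc N \<notin> prime_divisors_upto N I n" by (simp add: prime_divisors_upto_def)
  ultimately show ?thesis by simp
qed

lemma rough_divisors_Suc_not_prime: "\<not> prime (Suc N) \<Longrightarrow> rough_divisors (Suc N) n = rough_divisors N n"
  by (auto simp: rough_divisors_def le_Suc_eq)

lemma finite_rough_divisors: "n > 0 \<Longrightarrow> finite (rough_divisors N n)"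
  by (rule finite_subset[of _ "{d. d dvd n}"]) (auto simp: rough_divisors_def)

lemma rough_divisors_Suc_prime:
  assumes "prime (Suc N)"
  shows "rough_divisors (Suc N) n = {d \<in> rough_divisors N n. \<not> Suc N dvd d}"
  using assms by (auto simp: rough_divisors_def le_Suc_eq)

lemma mult_mem_rough_divisors_iff:
  assumes q: "prime q" "q > N"
  shows "q * d \<in> rough_divisors N (q * n) \<longleftrightarrow> d \<in> rough_divisors N n"
proof -
  have "\<not> p dvd q" if "prime p" "p \<le> N" for p
    using that q primes_dvd_imp_eq[of p q] by auto
  hence "p dvd q * d \<longleftrightarrow> p dvd d" if "prime p" "p \<le> N" for p
    using that by (simp add: prime_dvd_mult_iff)
  moreover have "q * d dvd q * n \<longleftrightarrow> d dvd n"
    using q by (simp add: prime_gt_0_nat)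
  ultimately show ?thesis
    unfolding rough_divisors_def by blast
qed

text \<open>The rough divisors divisible by \<open>q = Suc N\<close> are \<open>q * e\<close> with
  \<open>e\<close> a rough divisor of \<open>n div q\<close>; the others are rough for
  \<open>q\<close> too.\<close>

lemma card_rough_divisors_Suc:
  assumes q: "prime (Suc N)" and n: "n > 0"
  shows "real (card (rough_divisors N n)) -
      (if Suc N dvd n then real (card (rough_divisors N (n div Suc N))) else 0) =
    real (card (rough_divisors (Suc N) n))"
proof -
  obtain q where q_def: "q = Suc N" by blast
  define A where "A = {d \<in> rough_divisors N n. q dvd d}"
  have split: "rough_divisors N n = rough_divisors (Suc N) n \<union> A" "rough_divisors (Suc N) n \<inter> A = {}"
    unfolding rough_divisors_Suc_prime[OF q] A_def q_def by blast+
  have "finite A" "finite (rough_divisors (Suc N) n)"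
    using finite_rough_divisors[OF n] by (auto simp: A_def)
  hence "card (rough_divisors N n) = card (rough_divisors (Suc N) n) + card A"
    using split by (simp add: card_Un_disjoint)
  moreover have "card A = (if q dvd n then card (rough_divisors N (n div q)) else 0)"
  proof (cases "q dvd n")
    case True
    then obtain k where k: "n = q * k" by (elim dvdE)
    have mult: "q * d \<in> rough_divisors N n \<longleftrightarrow> d \<in> rough_divisors N k" for d
      unfolding k by (rule mult_mem_rough_divisors_iff) (use q in \<open>auto simp: q_def\<close>)
    have "A = (*) q ` rough_divisors N k"
    proof (intro equalityI subsetI)
      fix d assume d: "d \<in> A"
      then obtain e where "d = q * e" unfolding A_def by blast
      moreover from this d have "e \<in> rough_divisors N k"
        using mult by (simp add: A_def)
      ultimately show "d \<in> (*) q ` rough_divisors N k" by blast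
    qed (auto simp: A_def mult)
    hence "card A = card (rough_divisors N k)"
      by (simp add: card_image inj_on_def q_def del: mult_Suc)
    moreover have "n div q = k" unfolding k by (rule nonzero_mult_div_cancel_left) (simp add: q_def)
    ultimately show ?thesis using True by simp
  next
    case False
    hence "A = {}" unfolding A_def rough_divisors_def using dvd_trans by blast
    thus ?thesis using False by simp
  qed
  ultimately show ?thesis by (simp add: q_def)
qed

text \<open>Divisors coprime to the prime do not see that factor of \<open>n\<close>. Hence a second
  sieving by the same prime cancels all multiples of it.\<close>

lemma rough_divisors_Suc_div:
  assumes q: "prime (Suc N)" and dvd: "Suc N dvd n"
  shows "rough_divisors (Suc N) (n div Suc N) = rough_divisors (Suc N) n"
proof -
  obtain k where k: "n = Suc N * k" using dvd by (elim dvdE)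
  have n: "n div Suc N = k" unfolding k by (rule nonzero_mult_div_cancel_left) simp
  have "d dvd n \<longleftrightarrow> d dvd k" if "\<not> Suc N dvd d" for d
  proof -
    have "coprime d (Suc N)" using prime_imp_coprime[OF q that] by (rule coprime_imp_coprime) auto
    thus ?thesis unfolding k by (rule coprime_dvd_mult_right_iff)
  qed
  thus ?thesis using q unfolding rough_divisors_def n by blast
qed

text \<open>Invariant of the induction: each prime up to \<open>N\<close> dividing the coordinate
  product has become a factor 2, as in \<open>tau_star\<close>, while larger primes still enter
  through divisor counts.\<close>

lemma euler_op_box_sum:
  assumes I: "finite I"
  shows "euler_op I N (\<lambda>y. \<Prod>i\<in>I. divisor_sum (x * y i)) = (\<lambda>y. \<Sum>n\<in>box I x y.
    2 ^ card (prime_divisors_upto N I n) * (\<Prod>i\<in>I. real (card (rough_divisors N (n i)))))"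
proof (induction N)
  case 0
  have "prime_divisors_upto 0 I n = {}" for n
    by (auto simp: prime_divisors_upto_def)
  moreover have "rough_divisors 0 n = {d. d dvd n}" for n
    by (auto simp: rough_divisors_def)
  moreover have "finite {m. 1 \<le> m \<and> real m \<le> z}" for z
    by (rule finite_subset[of _ "{..nat \<lfloor>z\<rfloor>}"]) (auto simp: le_nat_iff le_floor_iff)
  ultimately show ?case
    using I by (simp add: box_def divisor_sum_def prod_sum_PiE)
next
  case (Suc N)
  let ?q = "Suc N"
  define c where "c n = (2::real) ^ card (prime_divisors_upto N I n)" for n
  define g where "g m = real (card (rough_divisors N m))" for m
  define g' where "g' m = real (card (rough_divisors ?q m))" for m
  have IH: "euler_op I N (\<lambda>y. \<Prod>i\<in>I. divisor_sum (x * y i)) =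
      (\<lambda>y. \<Sum>n\<in>box I x y. c n * (\<Prod>i\<in>I. g (n i)))"
    using Suc by (simp add: c_def g_def)
  show ?case
  proof (cases "prime ?q")
    case False
    hence "card (prime_divisors_upto ?q I n) = card (prime_divisors_upto N I n)" for n
      by (simp add: card_prime_divisors_upto_Suc)
    with False show ?thesis by (simp add: Suc rough_divisors_Suc_not_prime)
  next
    case True
    have c: "c (dilate S ?q n) = c n" for S n
      by (simp add: c_def prime_divisors_upto_dilate I True)
    have pos: "n i > 0" if "n \<in> box I x y" "i \<in> I" for n y i
      using that by (auto simp: box_def PiE_def Pi_def Suc_le_eq)
    have g: "g m - (if ?q dvd m then g (m div ?q) else 0) = g' m" if "m > 0" for m
      unfolding g_def g'_def by (rule card_rough_divisors_Suc[OF True that])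
    \<comment> \<open>One \<open>U\<close> removes the prime \<open>?q\<close> from the divisor
      counts.\<close>
    have U1: "sieve_op I ?q (\<lambda>y. \<Sum>n\<in>box I x y. c n * (\<Prod>i\<in>I. g (n i))) =
        (\<lambda>y. \<Sum>n\<in>box I x y. c n * (\<Prod>i\<in>I. g' (n i)))"
      by (rule ext, subst sieve_op_box_sum)
        (auto intro!: sum.cong prod.cong arg_cong2[of _ _ _ _ "(*)"] g pos simp: I c)
    \<comment> \<open>A second \<open>U\<close> keeps only tuples with no coordinate divisible by
      \<open>?q\<close>.\<close>
    have U2: "sieve_op I ?q (\<lambda>y. \<Sum>n\<in>box I x y. c n * (\<Prod>i\<in>I. g' (n i))) =
        (\<lambda>y. \<Sum>n\<in>box I x y. c n * (\<Prod>i\<in>I. if ?q dvd n i then 0 else g' (n i)))"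
      by (rule ext, subst sieve_op_box_sum)
        (auto intro!: sum.cong prod.cong arg_cong2[of _ _ _ _ "(*)"]
          simp: I c g'_def rough_divisors_Suc_div[OF True])
    \<comment> \<open>So \<open>2 * U - U\<^sup>2\<close> has weight 2 if \<open>?q\<close> divides
      the coordinate product, and \<open>2 - 1 = 1\<close> otherwise.\<close>
    have "2 * (c n * (\<Prod>i\<in>I. g' (n i))) - c n * (\<Prod>i\<in>I. if ?q dvd n i then 0 else g' (n i)) =
        2 ^ card (prime_divisors_upto ?q I n) * (\<Prod>i\<in>I. g' (n i))" for n
    proof (cases "?q dvd (\<Prod>i\<in>I. n i)")
      case dvd: True
      then obtain i where "i \<in> I" "?q dvd n i" using True I by (auto simp: prime_dvd_prod_iff)
      hence "(\<Prod>i\<in>I. if ?q dvd n i then 0 else g' (n i)) = 0"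
        using I by (intro prod_zero) auto
      thus ?thesis using dvd True by (simp add: card_prime_divisors_upto_Suc c_def)
    next
      case ndvd: False
      hence "\<not> ?q dvd n i" if "i \<in> I" for i using that True I by (auto simp: prime_dvd_prod_iff)
      hence "(\<Prod>i\<in>I. if ?q dvd n i then 0 else g' (n i)) = (\<Prod>i\<in>I. g' (n i))"
        by (intro prod.cong) auto
      thus ?thesis using ndvd by (simp add: card_prime_divisors_upto_Suc c_def)
    qed
    hence "local_op I ?q (\<lambda>y. \<Sum>n\<in>box I x y. c n * (\<Prod>i\<in>I. g (n i))) =
        (\<lambda>y. \<Sum>n\<in>box I x y. 2 ^ card (prime_divisors_upto ?q I n) * (\<Prod>i\<in>I. g' (n i)))"
      unfolding local_op_def U1 U2 by (simp add: sum_distrib_left flip: sum_subtractf)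
    thus ?thesis using True by (simp add: IH g'_def)
  qed
qed

text \<open>All coordinates are at most \<open>x \<le> N\<close>, hence so are their prime factors:
  only 1 is a rough divisor, and the primes counted are those of \<open>omega\<close>.\<close>

lemma tau_star_sum_eq:
  assumes "x \<le> real N"
  shows "real (tau_star_sum r x) = euler_op {1..r} N (\<lambda>y. \<Prod>i\<in>{1..r}. divisor_sum (x * y i)) (\<lambda>_. 1)"
proof -
  have "real (tau_star (\<Prod>i\<in>{1..r}. n i)) = 2 ^ card (prime_divisors_upto N {1..r} n) *
      (\<Prod>i\<in>{1..r}. real (card (rough_divisors N (n i))))" if n: "n \<in> box {1..r} x (\<lambda>_. 1)" for n
  proof -
    have ni: "n i > 0" "n i \<le> N" if "i \<in> {1..r}" for i
      using n that assms by (force simp: box_def PiE_def Pi_def Suc_le_eq)+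
    hence nz: "(\<Prod>i\<in>{1..r}. n i) \<noteq> 0" by force
    have "p \<le> N" if p: "prime p" "p dvd (\<Prod>i\<in>{1..r}. n i)" for p
    proof -
      obtain i where i: "i \<in> {1..r}" "p dvd n i" using p by (auto simp: prime_dvd_prod_iff)
      thus ?thesis using ni[OF i(1)] dvd_imp_le[of p "n i"] by linarith
    qed
    hence "prime_factors (\<Prod>i\<in>{1..r}. n i) = prime_divisors_upto N {1..r} n"
      using nz by (auto simp: prime_divisors_upto_def prime_factors_dvd)
    moreover have "rough_divisors N (n i) = {1}" if i: "i \<in> {1..r}" for i
    proof (intro equalityI subsetI)
      fix d assume d: "d \<in> rough_divisors N (n i)"
      have "d = 1"
      proof (rule ccontr)
        assume "d \<noteq> 1"
        then obtain p where p: "prime p" "p dvd d" using prime_factor_nat by blast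
        hence "p \<le> n i" using d ni[OF i] by (auto simp: rough_divisors_def intro: dvd_imp_le dvd_trans)
        thus False using d p ni[OF i] by (auto simp: rough_divisors_def)
      qed
      thus "d \<in> {1}" by simp
    qed (auto simp: rough_divisors_def not_prime_1)
    ultimately show ?thesis by (simp add: tau_star_def omega_def)
  qed
  thus ?thesis
    by (simp add: euler_op_box_sum tau_star_sum_def box_def)
qed

subsection \<open>The polynomial and the error term\<close>

text \<open>Expand over the sets \<open>X\<close> of coordinates that choose \<open>e\<close>; the
  empty set cancels. In every other term one factor \<open>b\<close> is kept and the remaining ones
  are raised to \<open>a\<close>.\<close>

lemma abs_prod_add_diff_le:
  fixes m e g :: "'i \<Rightarrow> real"
  assumes I: "finite I" and ab: "0 \<le> b" "b \<le> a"
    and m: "\<And>i. i \<in> I \<Longrightarrow> \<bar>m i\<bar> \<le> a * g i" and e: "\<And>i. i \<in> I \<Longrightarrow> \<bar>e i\<bar> \<le> b * g i"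
    and g: "\<And>i. i \<in> I \<Longrightarrow> g i \<ge> 0"
  shows "\<bar>(\<Prod>i\<in>I. e i + m i) - (\<Prod>i\<in>I. m i)\<bar> \<le> 2 ^ card I * (b * a ^ (card I - 1)) * (\<Prod>i\<in>I. g i)"
proof -
  let ?B = "b * a ^ (card I - 1) * (\<Prod>i\<in>I. g i)"
  have "(\<Prod>i\<in>I. e i + m i) = (\<Sum>X\<in>Pow I. (\<Prod>i\<in>X. e i) * (\<Prod>i\<in>I-X. m i))"
    by (rule prod_add[OF I])
  also have "\<dots> = (\<Prod>i\<in>I. m i) + (\<Sum>X\<in>Pow I - {{}}. (\<Prod>i\<in>X. e i) * (\<Prod>i\<in>I-X. m i))"
    using I by (subst sum.remove[of _ "{}"]) auto
  finally have "\<bar>(\<Prod>i\<in>I. e i + m i) - (\<Prod>i\<in>I. m i)\<bar> =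
      \<bar>\<Sum>X\<in>Pow I - {{}}. (\<Prod>i\<in>X. e i) * (\<Prod>i\<in>I-X. m i)\<bar>" by simp
  also have "\<dots> \<le> (\<Sum>X\<in>Pow I - {{}}. ?B)"
  proof (rule order_trans[OF sum_abs sum_mono])
    fix X assume X: "X \<in> Pow I - {{}}"
    hence finX: "finite X" and XI: "X \<subseteq> I" using I finite_subset by auto
    have "card X > 0" using X finX by auto
    then obtain k where k: "card X = Suc k" using gr0_conv_Suc by auto
    have cardI: "card X + card (I - X) = card I"
      using I XI finX by (simp add: card_Diff_subset card_mono)
    have "\<bar>(\<Prod>i\<in>X. e i) * (\<Prod>i\<in>I-X. m i)\<bar> = (\<Prod>i\<in>X. \<bar>e i\<bar>) * (\<Prod>i\<in>I-X. \<bar>m i\<bar>)"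
      by (simp add: abs_mult abs_prod)
    also have "\<dots> \<le> (\<Prod>i\<in>X. b * g i) * (\<Prod>i\<in>I-X. a * g i)"
      using e m g XI ab by (intro mult_mono prod_mono prod_nonneg mult_nonneg_nonneg conjI) auto
    also have "\<dots> = b ^ card X * a ^ card (I - X) * ((\<Prod>i\<in>X. g i) * (\<Prod>i\<in>I-X. g i))"
      by (simp add: prod.distrib)
    also have "(\<Prod>i\<in>X. g i) * (\<Prod>i\<in>I-X. g i) = (\<Prod>i\<in>I. g i)"
      using prod.subset_diff[OF XI I, of g] by (simp add: mult.commute)
    also have "b ^ card X * a ^ card (I - X) = b * (b ^ k * a ^ card (I - X))"
      by (simp add: k)
    also have "\<dots> \<le> b * (a ^ k * a ^ card (I - X))"
      using ab by (intro mult_left_mono mult_right_mono power_mono) auto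
    also have "a ^ k * a ^ card (I - X) = a ^ (card I - 1)"
    proof -
      have "card I - 1 = k + card (I - X)" using cardI k by simp
      thus ?thesis by (simp only: power_add)
    qed
    finally show "\<bar>(\<Prod>i\<in>X. e i) * (\<Prod>i\<in>I-X. m i)\<bar> \<le> ?B"
      using g by (simp add: mult_right_mono prod_nonneg)
  qed
  also have "\<dots> \<le> (\<Sum>X\<in>Pow I. ?B)"
    using I ab g by (intro sum_mono2 mult_nonneg_nonneg prod_nonneg) auto
  finally show ?thesis using I by (simp add: card_Pow mult.assoc)
qed

text \<open>Coefficient function of \<open>ln x ^ card J\<close> arising when exactly the
  coordinates in \<open>J\<close> supply the logarithm of \<open>x\<close>.\<close>

definition log_monomial :: "'i set \<Rightarrow> 'i set \<Rightarrow> ('i \<Rightarrow> real) \<Rightarrow> real" where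
  "log_monomial I J y = (\<Prod>i\<in>J. y i) * (\<Prod>i\<in>I-J. divisor_main (y i))"

text \<open>From \<open>divisor_main (x * y) = x * (ln x * y + divisor_main y)\<close>: expanding
  separates \<open>x\<close> from \<open>y\<close>, so the operators act on functions free of
  \<open>x\<close>.\<close>

lemma prod_divisor_main_scaled:
  assumes I: "finite I" and x: "x > 0" and y: "\<forall>i\<in>I. y i > 0"
  shows "(\<Prod>i\<in>I. divisor_main (x * y i)) =
    (\<Sum>J\<in>Pow I. x ^ card I * ln x ^ card J * log_monomial I J y)"
proof -
  have "(\<Prod>i\<in>I. divisor_main (x * y i)) = (\<Prod>i\<in>I. x * (ln x * y i + divisor_main (y i)))"
    using x y by (intro prod.cong) (auto simp: divisor_main_def ln_mult algebra_simps)
  also have "\<dots> = x ^ card I * (\<Prod>i\<in>I. ln x * y i + divisor_main (y i))"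
    by (simp add: prod.distrib)
  also have "\<dots> = (\<Sum>J\<in>Pow I. x ^ card I * ln x ^ card J * log_monomial I J y)"
    by (simp add: prod_add[OF I] sum_distrib_left prod.distrib log_monomial_def mult_ac)
  finally show ?thesis .
qed

text \<open>The choice \<open>\<delta> = 1/4\<close> gives exponents that enclose the exponent 1 of
  a plain coordinate, the lower one still above 1/2 as convergence demands.\<close>

lemma dominated_log_monomial:
  assumes I: "finite I"
  obtains B where "B \<ge> 0" "\<And>J. J \<subseteq> I \<Longrightarrow> dominated I (3/4) (5/4) B (log_monomial I J)"
proof -
  obtain K where K: "K \<ge> 1"
    and main: "\<And>y. y > 0 \<Longrightarrow> \<bar>divisor_main y\<bar> \<le> K * (y powr (3/4) + y powr (5/4))"
  proof -
    have "1/2 + 1/4 = (3/4::real)" "1 + 1/4 = (5/4::real)" by simp_all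
    from divisor_sum_bounds[of "1/4", unfolded this] show thesis
      using that by (metis divide_pos_pos order_refl zero_less_numeral zero_less_one)
  qed
  have "\<bar>log_monomial I J y\<bar> \<le> K ^ card I * weight I (3/4) (5/4) y"
    if J: "J \<subseteq> I" and y: "\<forall>i\<in>I. y i > 0" for J y
  proof -
    have "\<bar>log_monomial I J y\<bar> = (\<Prod>i\<in>J. \<bar>y i\<bar>) * (\<Prod>i\<in>I-J. \<bar>divisor_main (y i)\<bar>)"
      by (simp add: log_monomial_def abs_mult abs_prod)
    also have "\<dots> \<le> (\<Prod>i\<in>J. K * (y i powr (3/4) + y i powr (5/4))) *
        (\<Prod>i\<in>I-J. K * (y i powr (3/4) + y i powr (5/4)))"
    proof (intro mult_mono prod_mono prod_nonneg conjI)
      fix i assume "i \<in> J"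
      hence pos: "y i > 0" using J y by auto
      have "y i powr 1 \<le> y i powr (3/4) + y i powr (5/4)"
      proof (cases "y i \<ge> 1")
        case True
        hence "y i powr 1 \<le> y i powr (5/4)" by (intro powr_mono) auto
        thus ?thesis by (simp add: add_increasing)
      next
        case False
        hence "y i powr 1 \<le> y i powr (3/4)" using pos by (intro powr_mono') auto
        thus ?thesis by (simp add: add_increasing2)
      qed
      also have "\<dots> \<le> K * (y i powr (3/4) + y i powr (5/4))"
        using K mult_right_mono[of 1 K "y i powr (3/4) + y i powr (5/4)"] by simp
      finally show "\<bar>y i\<bar> \<le> K * (y i powr (3/4) + y i powr (5/4))" using pos by simp
    qed (use main y K J in auto)
    also have "\<dots> = (\<Prod>i\<in>I. K * (y i powr (3/4) + y i powr (5/4)))"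
      by (subst mult.commute) (rule prod.subset_diff[OF J I, symmetric])
    also have "\<dots> = K ^ card I * weight I (3/4) (5/4) y"
      by (simp add: weight_def prod.distrib)
    finally show ?thesis .
  qed
  thus thesis using K by (intro that[of "K ^ card I"]) (auto simp: dominated_def)
qed

text \<open>One coordinate carries the error exponent and the others the main one: \<open>1/2 +
  \<delta> + (r - 1) * (1 + \<delta>) = r - 1/2 + r * \<delta>\<close> with
  \<open>r = card I\<close>.\<close>

lemma dominated_divisor_error:
  assumes I: "finite I" "I \<noteq> {}" and \<delta>: "0 < \<delta>" "\<delta> \<le> 1/4"
  obtains B where "B \<ge> 0"
    "\<And>x. x \<ge> 1 \<Longrightarrow> dominated I (1/2 + \<delta>) (1 + \<delta>) (B * x powr (real (card I) - 1/2 + real (card I) * \<delta>))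
      (\<lambda>y. (\<Prod>i\<in>I. divisor_sum (x * y i)) -
        (\<Sum>J\<in>Pow I. x ^ card I * ln x ^ card J * log_monomial I J y))"
proof -
  let ?s = "1/2 + \<delta>" and ?t = "1 + \<delta>"
  obtain K where K: "K \<ge> 1"
    and main: "\<And>y. y > 0 \<Longrightarrow> \<bar>divisor_main y\<bar> \<le> K * (y powr ?s + y powr ?t)"
    and err: "\<And>y. y > 0 \<Longrightarrow> \<bar>divisor_sum y - divisor_main y\<bar> \<le> K * y powr ?s"
    using divisor_sum_bounds[OF \<delta>] by blast
  obtain k where k: "card I = Suc k"
    using I by (metis card_gt_0_iff gr0_conv_Suc)
  have "\<bar>(\<Prod>i\<in>I. divisor_sum (x * y i)) - (\<Sum>J\<in>Pow I. x ^ card I * ln x ^ card J * log_monomial I J y)\<bar>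
      \<le> 2 ^ card I * K ^ card I * x powr (real (card I) - 1/2 + real (card I) * \<delta>) * weight I ?s ?t y"
    if x: "x \<ge> 1" and y: "\<forall>i\<in>I. y i > 0" for x y
  proof -
    have st: "x powr ?s \<le> x powr ?t" using x by (intro powr_mono) auto
    have diff: "\<bar>(\<Prod>i\<in>I. (divisor_sum (x * y i) - divisor_main (x * y i)) + divisor_main (x * y i)) -
        (\<Prod>i\<in>I. divisor_main (x * y i))\<bar>
      \<le> 2 ^ card I * ((K * x powr ?s) * (K * x powr ?t) ^ (card I - 1)) * (\<Prod>i\<in>I. y i powr ?s + y i powr ?t)"
    proof (rule abs_prod_add_diff_le[OF I(1)])
      fix i assume "i \<in> I"
      hence yi: "y i > 0" using y by auto
      have "\<bar>divisor_main (x * y i)\<bar> \<le> K * ((x * y i) powr ?s + (x * y i) powr ?t)"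
        using x yi by (intro main) auto
      also have "\<dots> = K * (x powr ?s * y i powr ?s + x powr ?t * y i powr ?t)"
        using x yi by (simp add: powr_mult)
      also have "\<dots> \<le> K * (x powr ?t * y i powr ?s + x powr ?t * y i powr ?t)"
        using K st by (intro mult_left_mono add_right_mono mult_right_mono) auto
      finally show "\<bar>divisor_main (x * y i)\<bar> \<le> K * x powr ?t * (y i powr ?s + y i powr ?t)"
        by (simp add: algebra_simps)
      have "\<bar>divisor_sum (x * y i) - divisor_main (x * y i)\<bar> \<le> K * (x * y i) powr ?s"
        using x yi by (intro err) auto
      also have "\<dots> = K * x powr ?s * y i powr ?s"
        using x yi by (simp add: powr_mult)
      also have "\<dots> \<le> K * x powr ?s * (y i powr ?s + y i powr ?t)"
        using K by (intro mult_left_mono) auto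
      finally show "\<bar>divisor_sum (x * y i) - divisor_main (x * y i)\<bar> \<le>
          K * x powr ?s * (y i powr ?s + y i powr ?t)" .
    qed (use K st in auto)
    have const: "(K * x powr ?s) * (K * x powr ?t) ^ (card I - 1) =
        K ^ card I * x powr (real (card I) - 1/2 + real (card I) * \<delta>)"
    proof -
      have "x powr s * (x powr t) ^ k = x powr (s + real k * t)" for s t
        using x by (simp add: powr_add powr_power mult.commute)
      hence "x powr ?s * (x powr ?t) ^ k = x powr (?s + real k * ?t)" .
      also have "?s + real k * ?t = real (card I) - 1/2 + real (card I) * \<delta>"
        by (simp add: k algebra_simps)
      finally show ?thesis by (simp add: k power_mult_distrib mult_ac)
    qed
    have "(\<Prod>i\<in>I. divisor_main (x * y i)) =
        (\<Sum>J\<in>Pow I. x ^ card I * ln x ^ card J * log_monomial I J y)"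
      using I x y by (intro prod_divisor_main_scaled) auto
    from diff[unfolded const this] show ?thesis
      by (simp add: weight_def mult.assoc)
  qed
  thus thesis
    using K by (intro that[of "2 ^ card I * K ^ card I"]) (auto simp: dominated_def)
qed

section \<open>The Euler product of the leading coefficient\<close>

lemma euler_factor_nonzero: "euler_factor r p \<noteq> 0"
proof (cases "prime p")
  case True
  hence p: "real p \<ge> 2" by (simp add: prime_ge_2_nat)
  define u where "u = (1 - 1 / real p) ^ r"
  have "u \<le> 1" unfolding u_def using p by (intro power_le_one) auto
  moreover have "u > 0" unfolding u_def using p by (intro zero_less_power) auto
  ultimately have "u * (2 - u) \<noteq> 0" by simp
  thus ?thesis by (simp add: euler_factor_def True flip: u_def)
qed (simp add: euler_factor_def)

text \<open>At a prime the deviation from 1 is \<open>(1 - u)\<^sup>2\<close> with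
  \<open>u = (1 - 1 / p) ^ r\<close>, and Bernoulli's inequality gives
  \<open>1 - u \<le> r / p\<close>.\<close>

lemma convergent_prod_euler_factor: "convergent_prod (euler_factor r)"
proof (rule abs_convergent_prod_imp_convergent_prod, rule summable_imp_abs_convergent_prod)
  show "summable (\<lambda>p. norm (euler_factor r p - 1))"
  proof (rule summable_comparison_test)
    show "summable (\<lambda>p. real r ^ 2 * (1 / real p ^ 2))"
      by (intro summable_mult) (use inverse_power_summable[of 2] in \<open>simp add: divide_inverse\<close>)
    show "\<exists>N. \<forall>p\<ge>N. norm (norm (euler_factor r p - 1)) \<le> real r ^ 2 * (1 / real p ^ 2)"
    proof (intro exI allI impI)
      fix p :: nat assume "p \<ge> 1"
      define u where "u = (1 - 1 / real p) ^ r"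
      have u: "u \<le> 1" "1 - u \<le> real r / p"
        using \<open>p \<ge> 1\<close> Bernoulli_inequality[of "- (1 / real p)" r]
        by (auto simp: u_def intro!: power_le_one)
      hence "(1 - u) ^ 2 \<le> (real r / p) ^ 2" by (intro power_mono) auto
      moreover have "u * (2 - u) - 1 = - ((1 - u) ^ 2)" by (simp add: power2_eq_square algebra_simps)
      ultimately have "\<bar>u * (2 - u) - 1\<bar> \<le> real r ^ 2 * (1 / real p ^ 2)"
        by (simp add: power_divide)
      thus "norm (norm (euler_factor r p - 1)) \<le> real r ^ 2 * (1 / real p ^ 2)"
        by (simp add: euler_factor_def u_def)
    qed
  qed
qed

theorem theorem5:
  fixes r :: nat
  assumes "r \<ge> 2"
  shows "\<exists>P :: real poly.
           degree P = r \<and>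
           (\<lambda>p. if prime p
                then (1 - 1 / real p) ^ r * (2 - (1 - 1 / real p) ^ r)
                else 1) has_prod lead_coeff P \<and>
           (\<forall>\<epsilon>::real. \<epsilon> > 0 \<longrightarrow>
              (\<lambda>x::real. real (tau_star_sum r x) - x ^ r * poly P (ln x))
                \<in> O[at_top](\<lambda>x. x powr (real r - 1 / 2 + \<epsilon>)))"
proof -
  define I where "I = {1..r}"
  have I: "finite I" "I \<noteq> {}" "card I = r" using assms by (auto simp: I_def)
  obtain B0 where B0: "B0 \<ge> 0" "\<And>J. J \<subseteq> I \<Longrightarrow> dominated I (3/4) (5/4) B0 (log_monomial I J)"
    using dominated_log_monomial[OF I(1)] by blast
  \<comment> \<open>Values at \<open>y = 1\<close> of the truncated operators; their limits
    \<open>L J\<close> become the coefficients of \<open>P\<close>.\<close>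
  define E where "E J N = euler_op I N (log_monomial I J) (\<lambda>_. 1)" for J N
  define L where "L J = lim (E J)" for J
  have L: "E J \<longlonglongrightarrow> L J" if "J \<subseteq> I" for J
  proof -
    have "convergent (\<lambda>N. euler_op I N (log_monomial I J) (\<lambda>_. 1))"
      by (rule convergent_euler_op[OF I(1) _ _ B0(1) B0(2)]) (use that in auto)
    thus ?thesis unfolding L_def E_def convergent_LIMSEQ_iff .
  qed
  define P where "P = (\<Sum>J\<in>Pow I. monom (L J) (card J))"
  have poly_P: "poly P t = (\<Sum>J\<in>Pow I. L J * t ^ card J)" for t
    by (simp add: P_def poly_sum poly_monom)
  have "coeff P r = (\<Sum>J\<in>Pow I. if J = I then L J else 0)"
    unfolding P_def coeff_sum coeff_monom
    by (intro sum.cong refl) (use I card_subset_eq in \<open>auto split: if_splits\<close>)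
  hence coeff_r: "coeff P r = L I" using I by simp
  \<comment> \<open>For \<open>J = I\<close> the monomial is the common eigenfunction, so
    \<open>E I N\<close> is a partial Euler product.\<close>
  have "log_monomial I I = (\<lambda>y. \<Prod>i\<in>I. y i)" by (rule ext) (simp add: log_monomial_def)
  hence "E I = (\<lambda>N. \<Prod>p\<le>N. euler_factor r p)" by (rule_tac ext) (simp add: E_def euler_op_prod I)
  moreover have "(\<lambda>N. \<Prod>p\<le>N. euler_factor r p) \<longlonglongrightarrow> prodinf (euler_factor r)"
    by (rule convergent_prod_LIMSEQ[OF convergent_prod_euler_factor])
  ultimately have "L I = prodinf (euler_factor r)" using L[of I] LIMSEQ_unique by auto
  hence prodL: "euler_factor r has_prod L I"
    using convergent_prod_has_prod[OF convergent_prod_euler_factor] by simp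
  \<comment> \<open>A \<open>has_prod\<close> limit vanishes only if some factor does; this makes
    the degree exactly \<open>r\<close>.\<close>
  hence "L I \<noteq> 0" using has_prod_eq_0_iff[OF prodL] euler_factor_nonzero[of r] by (metis imageE)
  moreover have "degree P \<le> r"
    unfolding P_def using I card_mono[OF I(1)]
    by (intro degree_sum_le) (auto intro: order_trans[OF degree_monom_le])
  ultimately have deg: "degree P = r"
    using coeff_r by (intro antisym le_degree) auto
  have asymp: "(\<lambda>x. real (tau_star_sum r x) - x ^ r * poly P (ln x))
      \<in> O[at_top](\<lambda>x. x powr (real r - 1 / 2 + \<epsilon>))" if \<epsilon>: "\<epsilon> > 0" for \<epsilon>
  proof -
    \<comment> \<open>The exponent loses \<open>r * \<delta>\<close>, which must stay within
      \<open>\<epsilon>\<close>; the divisor bounds require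
      \<open>\<delta> \<le> 1/4\<close>.\<close>
    define \<delta> where "\<delta> = min (1/4) (\<epsilon> / r)"
    have \<delta>: "0 < \<delta>" "\<delta> \<le> 1/4" "r * \<delta> \<le> \<epsilon>"
      using assms \<epsilon> by (auto simp: \<delta>_def min_def field_simps)
    let ?s = "1/2 + \<delta>" and ?t = "1 + \<delta>" and ?a = "real r - 1/2 + real r * \<delta>"
    obtain B where B: "B \<ge> 0" "\<And>x. x \<ge> 1 \<Longrightarrow> dominated I ?s ?t (B * x powr ?a)
        (\<lambda>y. (\<Prod>i\<in>I. divisor_sum (x * y i)) - (\<Sum>J\<in>Pow I. x ^ r * ln x ^ card J * log_monomial I J y))"
      using dominated_divisor_error[OF I(1,2) \<delta>(1,2)] unfolding I(3) by blast
    define C where "C = exp (suminf (defect_coeff r ?s)) * B * weight I ?s ?t (\<lambda>_. 1)"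
    have C: "C \<ge> 0" using B weight_nonneg[of I ?s ?t] by (simp add: C_def)
    \<comment> \<open>For fixed \<open>x\<close> the bound is shown with \<open>E J N\<close> in
      place of \<open>L J\<close> for every \<open>N \<ge> x\<close>; as \<open>C\<close> is free of
      \<open>N\<close>, it survives the limit.\<close>
    have bound: "\<bar>real (tau_star_sum r x) - x ^ r * poly P (ln x)\<bar> \<le> C * x powr ?a" if x: "x \<ge> 1" for x
    proof (rule LIMSEQ_le_const2)
      show "(\<lambda>N. \<bar>real (tau_star_sum r x) - (\<Sum>J\<in>Pow I. x ^ r * ln x ^ card J * E J N)\<bar>)
          \<longlonglongrightarrow> \<bar>real (tau_star_sum r x) - x ^ r * poly P (ln x)\<bar>"
        unfolding poly_P sum_distrib_left
        by (rule tendsto_eq_intros L refl | simp add: mult_ac)+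
      show "\<exists>M. \<forall>N\<ge>M. \<bar>real (tau_star_sum r x) - (\<Sum>J\<in>Pow I. x ^ r * ln x ^ card J * E J N)\<bar> \<le> C * x powr ?a"
      proof (intro exI allI impI)
        fix N assume "N \<ge> nat \<lceil>x\<rceil>"
        hence N: "x \<le> real N" by linarith
        let ?err = "\<lambda>y. (\<Prod>i\<in>I. divisor_sum (x * y i)) - (\<Sum>J\<in>Pow I. x ^ r * ln x ^ card J * log_monomial I J y)"
        have "dominated I ?s ?t (exp (suminf (defect_coeff r ?s)) * (B * x powr ?a)) (euler_op I N ?err)"
          unfolding I(3)[symmetric]
          by (rule dominated_euler_op) (use I B x \<delta> in auto)
        hence "\<bar>euler_op I N ?err (\<lambda>_. 1)\<bar> \<le> C * x powr ?a"
          by (simp add: dominated_def C_def mult_ac)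
        \<comment> \<open>By linearity the two parts separate, and on the divisor sums the operator
          gives \<open>tau_star_sum r x\<close> exactly, independently of \<open>N\<close>.\<close>
        moreover have "euler_op I N ?err (\<lambda>_. 1) =
            real (tau_star_sum r x) - (\<Sum>J\<in>Pow I. x ^ r * ln x ^ card J * E J N)"
          using tau_star_sum_eq[OF N, of r] by (simp add: euler_op_diff euler_op_sum E_def I_def)
        ultimately show "\<bar>real (tau_star_sum r x) - (\<Sum>J\<in>Pow I. x ^ r * ln x ^ card J * E J N)\<bar> \<le> C * x powr ?a"
          by simp
      qed
    qed
    show ?thesis
    proof (rule bigoI)
      show "\<forall>\<^sub>F x in at_top. norm (real (tau_star_sum r x) - x ^ r * poly P (ln x)) \<le>
          C * norm (x powr (real r - 1 / 2 + \<epsilon>))"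
        using eventually_ge_at_top[of 1]
      proof eventually_elim
        case (elim x)
        have "C * x powr ?a \<le> C * x powr (real r - 1 / 2 + \<epsilon>)"
          using C \<delta> elim by (intro mult_left_mono powr_mono) auto
        with bound[OF elim] show ?case by simp
      qed
    qed
  qed
  show ?thesis
  proof (intro exI conjI allI impI)
    show "(\<lambda>p. if prime p then (1 - 1 / real p) ^ r * (2 - (1 - 1 / real p) ^ r) else 1) has_prod lead_coeff P"
      using prodL by (simp add: deg coeff_r euler_factor_def [abs_def])
  qed (use deg asymp in auto)
qed

end
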